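(* Let $X$ be any finite subset of the standard infinite generating set $\{x_k : k\ge 0\}$ of Thompson's group $F$ such that $x_0\in X$ and $X$ generates $F$. Then $F$ is not almost convex with respect to $X$.
   Context: Thompson's group $F$ is the group with presentation $\langle x_k,\ k\ge 0 \mid x_i^{-1}x_jx_i=x_{j+1}\ \text{if } i<j\rangle$; $\{x_k : k\ge 0\}$ is its standard infinite generating set. For a group $G$ with finite generating set $X$, $\Gamma(G,X)$ denotes the Cayley graph with vertex set $G$ and edges joining $g$ to $gx$ for $x\in X^{\pm1}$; all edges have length 1, and $d_X(g,h)$ (the least $n$ such that $g^{-1}h$ is a product of $n$ elements of $X^{\pm1}$) is the resulting word metric. $B(m)$ denotes the ball of radius $m$ centered at the identity; paths are edge paths in $\Gamma(G,X)$. Almost convex: $G$ is almost convex with respect to $X$ if there is a constant $L$ such that for every positive integer $m$, any two elements $x,y\in B(m)$ with $d_X(x,y)\le2$ can be joined by a path of length at most $L$ lying in $B(m)$. *)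

theory Defs
  imports "HOL-Algebra.Generated_Groups"
begin

section \<open>Groups given by presentations\<close>

text \<open>A letter \<open>(a, True)\<close> stands for the generator \<open>a\<close>, and \<open>(a, False)\<close> for its formal inverse.\<close>

type_synonym 'a group_word = "('a \<times> bool) list"

inductive pres_eq :: "'a group_word set \<Rightarrow> 'a group_word \<Rightarrow> 'a group_word \<Rightarrow> bool"
  for R :: "'a group_word set"
where
  refl: "pres_eq R u u"
| sym: "pres_eq R u v \<Longrightarrow> pres_eq R v u"
| trans: "pres_eq R u v \<Longrightarrow> pres_eq R v w \<Longrightarrow> pres_eq R u w"
| cancel: "pres_eq R (u @ [(a, b), (a, \<not> b)] @ v) (u @ v)"
| relator: "r \<in> R \<Longrightarrow> pres_eq R (u @ r @ v) (u @ v)"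

definition pres_class :: "'a group_word set \<Rightarrow> 'a group_word \<Rightarrow> 'a group_word set" where
  "pres_class R u = {v. pres_eq R u v}"

text \<open>The group presented by the generators \<open>UNIV :: 'a set\<close> and the relators \<open>R\<close>. The union in
  the product is that of a single class, see \<open>pres_mult\<close> below.\<close>

definition presented_group :: "'a group_word set \<Rightarrow> 'a group_word set monoid" where
  "presented_group R =
     \<lparr> carrier = range (pres_class R),
       mult = (\<lambda>A B. \<Union>u\<in>A. \<Union>v\<in>B. pres_class R (u @ v)),
       one = pres_class R [] \<rparr>"

lemma pres_eq_context:
  assumes "pres_eq R u v"
  shows "pres_eq R (p @ u @ q) (p @ v @ q)"
  using assms
proof (induction rule: pres_eq.induct)
  case (cancel u a b v)
  show ?case using pres_eq.cancel[of R "p @ u" a b "v @ q"] by simp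
next
  case (relator r u v)
  show ?case using pres_eq.relator[OF relator, of "p @ u" "v @ q"] by simp
next
  case (refl u)
  show ?case by (rule pres_eq.refl)
next
  case (sym u v)
  show ?case by (rule pres_eq.sym[OF sym.IH])
next
  case (trans u v w)
  show ?case by (rule pres_eq.trans[OF trans.IH])
qed

lemma pres_eq_append:
  assumes "pres_eq R u u'" "pres_eq R v v'"
  shows "pres_eq R (u @ v) (u' @ v')"
proof (rule pres_eq.trans)
  show "pres_eq R (u @ v) (u' @ v)"
    using pres_eq_context[OF assms(1), of "[]" v] by simp
  show "pres_eq R (u' @ v) (u' @ v')"
    using pres_eq_context[OF assms(2), of u' "[]"] by simp
qed

lemma pres_class_eq_iff: "pres_class R u = pres_class R v \<longleftrightarrow> pres_eq R u v"
  unfolding pres_class_def set_eq_iff mem_Collect_eq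
  by (metis pres_eq.refl pres_eq.sym pres_eq.trans)

lemma pres_mult [simp]:
  "pres_class R u \<otimes>\<^bsub>presented_group R\<^esub> pres_class R v = pres_class R (u @ v)"
proof -
  have *: "pres_class R (u' @ v') = pres_class R (u @ v)"
    if "u' \<in> pres_class R u" "v' \<in> pres_class R v" for u' v'
    using that unfolding pres_class_eq_iff
    by (simp add: pres_class_def pres_eq.sym pres_eq_append)
  have mem: "u \<in> pres_class R u" "v \<in> pres_class R v"
    by (simp_all add: pres_class_def pres_eq.refl)
  have "(\<Union>u'\<in>pres_class R u. \<Union>v'\<in>pres_class R v. pres_class R (u' @ v'))
      = (\<Union>u'\<in>pres_class R u. \<Union>v'\<in>pres_class R v. pres_class R (u @ v))"
    by (rule SUP_cong[OF HOL.refl], rule SUP_cong[OF HOL.refl], rule *)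
  also have "\<dots> = pres_class R (u @ v)"
    using mem by blast
  finally show ?thesis
    by (simp add: presented_group_def)
qed

lemma pres_one: "\<one>\<^bsub>presented_group R\<^esub> = pres_class R []"
  and pres_carrier: "carrier (presented_group R) = range (pres_class R)"
  by (simp_all add: presented_group_def)

definition inv_word :: "'a group_word \<Rightarrow> 'a group_word" where
  "inv_word u = rev (map (\<lambda>(a, b). (a, \<not> b)) u)"

lemma pres_eq_inv_word: "pres_eq R (inv_word u @ u) []"
proof (induction u)
  case Nil
  show ?case by (simp add: inv_word_def pres_eq.refl)
next
  case (Cons l u)
  obtain a b where l: "l = (a, b)" by (cases l)
  have "pres_eq R (inv_word u @ [(a, \<not> b), (a, \<not> \<not> b)] @ u) (inv_word u @ u)"
    by (rule pres_eq.cancel)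
  then have "pres_eq R (inv_word (l # u) @ (l # u)) (inv_word u @ u)"
    by (simp add: inv_word_def l)
  then show ?case using Cons.IH by (rule pres_eq.trans)
qed

lemma group_presented_group: "group (presented_group R)"
proof (rule groupI)
  fix A assume "A \<in> carrier (presented_group R)"
  then obtain u where "A = pres_class R u" by (auto simp: pres_carrier)
  then have "pres_class R (inv_word u) \<otimes>\<^bsub>presented_group R\<^esub> A = \<one>\<^bsub>presented_group R\<^esub>"
    by (simp add: pres_one pres_class_eq_iff pres_eq_inv_word)
  then show "\<exists>B\<in>carrier (presented_group R). B \<otimes>\<^bsub>presented_group R\<^esub> A = \<one>\<^bsub>presented_group R\<^esub>"
    by (auto simp: pres_carrier)
qed (auto simp: pres_carrier pres_one)

lemma pres_inv: "inv\<^bsub>presented_group R\<^esub> (pres_class R u) = pres_class R (inv_word u)"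
proof -
  interpret group "presented_group R" by (rule group_presented_group)
  show ?thesis
    by (rule inv_equality)
       (simp_all add: pres_carrier rangeI pres_one pres_class_eq_iff pres_eq_inv_word)
qed


section \<open>Thompson's group \<open>F\<close>\<close>

text \<open>The relators are \<open>x\<^sub>i\<^sup>-\<^sup>1 x\<^sub>j x\<^sub>i x\<^sub>j\<^sub>+\<^sub>1\<^sup>-\<^sup>1\<close> for \<open>i < j\<close>.\<close>

definition thompson_relators :: "nat group_word set" where
  "thompson_relators = {[(i, False), (j, True), (i, True), (Suc j, False)] | i j. i < j}"

definition thompson_F :: "nat group_word set monoid" where
  "thompson_F = presented_group thompson_relators"

definition thompson_x :: "nat \<Rightarrow> nat group_word set" where
  "thompson_x k = pres_class thompson_relators [(k, True)]"

lemma group_thompson_F: "group thompson_F"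
  unfolding thompson_F_def by (rule group_presented_group)

lemma thompson_x_closed: "thompson_x k \<in> carrier thompson_F"
  by (simp add: thompson_F_def thompson_x_def pres_carrier rangeI)

lemma thompson_relation:
  assumes "i < j"
  shows "inv\<^bsub>thompson_F\<^esub> (thompson_x i) \<otimes>\<^bsub>thompson_F\<^esub> thompson_x j \<otimes>\<^bsub>thompson_F\<^esub> thompson_x i
           = thompson_x (Suc j)"
proof -
  let ?u = "[(i, False), (j, True), (i, True)]"
  have "?u @ [(Suc j, False)] \<in> thompson_relators"
    using assms by (auto simp: thompson_relators_def)
  from pres_eq.relator[OF this, of "[]" "[(Suc j, True)]"]
  have "pres_eq thompson_relators (?u @ [(Suc j, False), (Suc j, True)]) [(Suc j, True)]"
    by simp
  moreover have "pres_eq thompson_relators (?u @ [(Suc j, False), (Suc j, True)]) ?u"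
    using pres_eq.cancel[of thompson_relators ?u "Suc j" False "[]"] by simp
  ultimately have "pres_eq thompson_relators ?u [(Suc j, True)]"
    by (rule pres_eq.trans[OF pres_eq.sym, rotated])
  then show ?thesis
    by (simp add: thompson_F_def thompson_x_def pres_inv inv_word_def pres_class_eq_iff)
qed


section \<open>Cayley graphs and almost convexity\<close>

definition sym_gens :: "('a, 'b) monoid_scheme \<Rightarrow> 'a set \<Rightarrow> 'a set" where
  "sym_gens G X = X \<union> (\<lambda>x. inv\<^bsub>G\<^esub> x) ` X"

definition list_product :: "('a, 'b) monoid_scheme \<Rightarrow> 'a list \<Rightarrow> 'a" where
  "list_product G ws = foldr (\<lambda>g h. g \<otimes>\<^bsub>G\<^esub> h) ws \<one>\<^bsub>G\<^esub>"

text \<open>Only meaningful if \<open>X\<close> generates the group \<open>G\<close>; otherwise the \<open>LEAST\<close> may range over the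
  empty set.\<close>

definition word_dist :: "('a, 'b) monoid_scheme \<Rightarrow> 'a set \<Rightarrow> 'a \<Rightarrow> 'a \<Rightarrow> nat" where
  "word_dist G X g h =
     (LEAST n. \<exists>ws. length ws = n \<and> set ws \<subseteq> sym_gens G X \<and> inv\<^bsub>G\<^esub> g \<otimes>\<^bsub>G\<^esub> h = list_product G ws)"

definition word_ball :: "('a, 'b) monoid_scheme \<Rightarrow> 'a set \<Rightarrow> nat \<Rightarrow> 'a set" where
  "word_ball G X m = {g \<in> carrier G. word_dist G X \<one>\<^bsub>G\<^esub> g \<le> m}"

definition cayley_adj :: "('a, 'b) monoid_scheme \<Rightarrow> 'a set \<Rightarrow> 'a \<Rightarrow> 'a \<Rightarrow> bool" where
  "cayley_adj G X g h \<longleftrightarrow> g \<in> carrier G \<and> (\<exists>x\<in>sym_gens G X. h = g \<otimes>\<^bsub>G\<^esub> x)"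

text \<open>An edge path is given by its nonempty list of vertices, so its length is one less than that of
  the list.\<close>

definition cayley_path :: "('a, 'b) monoid_scheme \<Rightarrow> 'a set \<Rightarrow> 'a \<Rightarrow> 'a list \<Rightarrow> 'a \<Rightarrow> bool" where
  "cayley_path G X g p h \<longleftrightarrow>
     p \<noteq> [] \<and> set p \<subseteq> carrier G \<and> hd p = g \<and> last p = h \<and> successively (cayley_adj G X) p"

definition path_length :: "'a list \<Rightarrow> nat" where
  "path_length p = length p - 1"

text \<open>A path lies in a ball if all its vertices do. For Thompson's group with generators among the
  \<open>x\<^sub>k\<close> this also settles the edges: all relators have even length, so no edge joins two vertices
  at the same distance from the identity.\<close>

definition almost_convex :: "('a, 'b) monoid_scheme \<Rightarrow> 'a set \<Rightarrow> bool" where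
  "almost_convex G X \<longleftrightarrow>
     (\<exists>L. \<forall>m>0. \<forall>x\<in>word_ball G X m. \<forall>y\<in>word_ball G X m. word_dist G X x y \<le> 2 \<longrightarrow>
        (\<exists>p. cayley_path G X x p y \<and> path_length p \<le> L \<and> set p \<subseteq> word_ball G X m))"

end

theory Submission
  imports Defs Complex_Main
begin

text \<open>The group acts on the real line from the right: \<open>x\<^sub>0\<close> is the translation by 1, and \<open>x\<^sub>i\<close> for
  \<open>i \<ge> 1\<close> fixes \<open>(-\<infinity>, i - 1]\<close>, doubles \<open>[i - 1, i]\<close> and translates \<open>[i, \<infinity>)\<close> by 1. Let \<open>n\<close> be the
  largest index of a generator in \<open>X\<close>. Outside the window \<open>[0, n + 1]\<close> every letter acts as a
  translation: to the left of it only \<open>x\<^sub>0\<^sup>\<plusminus>\<^sup>1\<close> moves points, to the right of it every letter does. So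
  if a word breaks the translation pattern near a point far to the left or far to the right, some
  prefix of the word has carried that point into the window.

  Choose \<open>a \<ge> 1\<close> with \<open>x\<^sub>a \<in> X\<close>. The element
  \<open>g = x\<^sub>0\<^sup>-\<^sup>D x\<^sub>a x\<^sub>0\<^sup>D x\<^sub>0\<^sup>N x\<^sub>a x\<^sub>0\<^sup>-\<^sup>N = x\<^sub>0\<^sup>N x\<^sub>a x\<^sub>0\<^sup>-\<^sup>N x\<^sub>0\<^sup>-\<^sup>D\<^sup>-\<^sup>1 x\<^sub>a x\<^sub>0\<^sup>D\<^sup>+\<^sup>1\<close>
  breaks the pattern near \<open>-N\<close> and near \<open>D\<close>. A word for it has to tour both places and come back, at
  a cost of about \<open>2N + 2D\<close>, and it may make the two excursions in either order. Stopping \<open>H\<close> letters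
  before the end gives \<open>g x\<^sub>0\<^sup>H\<close> (right excursion first) or \<open>g x\<^sub>0\<^sup>-\<^sup>H\<close> (left excursion first). Both have
  length at most \<open>m = 2N + 2D + 4 - H\<close>, and their distance is at most \<open>2H\<close>.

  Now follow a path of bounded length from \<open>g x\<^sub>0\<^sup>H\<close> to \<open>g x\<^sub>0\<^sup>-\<^sup>H\<close> and stop when the image of the right
  half-line first touches the window. So far the half-line has only been translated
  (\<open>first_crossing\<close>), and the part of the line near \<open>-N\<close> is too far away to have been
  reached. Hence both excursions are still needed, and nothing is saved by stopping early:
  \<open>length_lower_bound\<close> gives length at least \<open>2N + 2D - 3n - 5\<close>, which exceeds \<open>m\<close> if
  \<open>H = 3n + 10\<close>. So a path inside the ball \<open>B(m)\<close> cannot have bounded length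
  (\<open>no_short_path_between_tours\<close>).

  Almost convexity speaks of pairs at distance 2 only, but by an argument of Cannon it bounds the
  distance inside the ball for pairs at any fixed distance, in particular \<open>2H\<close>: the farthest
  vertices of a path can be bypassed one layer at a time (\<open>almost_convex_far\<close>).\<close>

abbreviation F_eq :: "nat group_word \<Rightarrow> nat group_word \<Rightarrow> bool"  (infix "\<approx>" 50) where
  "u \<approx> v \<equiv> pres_eq thompson_relators u v"

section \<open>The action on the real line\<close>

text \<open>The piecewise linear action of the letters. For \<open>x\<^sub>j\<^sub>+\<^sub>1\<close> the displacement grows from 0 to 1 between
  \<open>j\<close> and \<open>j + 1\<close>, and for its inverse from 0 to \<open>-1\<close> between \<open>j\<close> and \<open>j + 2\<close>. Words act from left
  to right, so prefixes of a word, that is, the vertices of a path in the Cayley graph, give the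
  successive positions of a point.\<close>

fun letter_act :: "nat \<times> bool \<Rightarrow> real \<Rightarrow> real" where
  "letter_act (0, True) t = t + 1"
| "letter_act (0, False) t = t - 1"
| "letter_act (Suc j, True) t = t + max 0 (min 1 (t - j))"
| "letter_act (Suc j, False) t = t - max 0 (min 1 ((t - j) / 2))"

abbreviation word_act :: "nat group_word \<Rightarrow> real \<Rightarrow> real" where
  "word_act \<equiv> fold letter_act"

lemma letter_act_cancel: "letter_act (i, \<not> b) (letter_act (i, b) t) = t"
  by (cases i; cases b) (auto simp: max_def min_def field_simps)

text \<open>Both sides agree because everything to the right of \<open>j - 1 \<ge> i\<close> is translated by \<open>x\<^sub>i\<close>, which
  turns \<open>x\<^sub>j\<close> into \<open>x\<^sub>j\<^sub>+\<^sub>1\<close>.\<close>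

lemma letter_act_relation:
  assumes "i < j"
  shows "letter_act (i, True) (letter_act (j, True) t)
       = letter_act (Suc j, True) (letter_act (i, True) t)"
proof -
  obtain j' where j: "j = Suc j'" using assms by (cases j) auto
  show ?thesis
  proof (cases i)
    case 0
    then show ?thesis by (simp add: j)
  next
    case (Suc i')
    then have "real j' \<ge> real i' + 1" using assms j by simp
    then show ?thesis by (simp add: j Suc max_def min_def)
  qed
qed

lemma word_act_cong:
  assumes "u \<approx> v"
  shows "word_act u = word_act v"
  using assms
proof (induction rule: pres_eq.induct)
  case (cancel u a b v)
  show ?case by (simp add: letter_act_cancel fun_eq_iff)
next
  case (relator r u v)
  then obtain i j where r: "r = [(i, False), (j, True), (i, True), (Suc j, False)]" and "i < j"
    by (auto simp: thompson_relators_def)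
  have "word_act r t = t" for t
    using letter_act_relation[OF \<open>i < j\<close>, of "letter_act (i, False) t"]
      letter_act_cancel[of i False t] letter_act_cancel[of "Suc j" True t]
    by (simp add: r)
  then show ?case by (simp add: fun_eq_iff)
qed auto

text \<open>Near \<open>-\<infinity>\<close> a word is a translation by the exponent sum of \<open>x\<^sub>0\<close>, and near \<open>+\<infinity>\<close> by the sum of
  all exponents.\<close>

definition left_shift :: "nat group_word \<Rightarrow> real" where
  "left_shift w = (\<Sum>(i, b)\<leftarrow>w. if i = 0 then if b then 1 else -1 else 0)"

definition right_shift :: "nat group_word \<Rightarrow> real" where
  "right_shift w = (\<Sum>(i, b)\<leftarrow>w. if b then 1 else -1)"

lemma left_shift_simps [simp]:
  "left_shift [] = 0"
  "left_shift ((i, b) # v) = (if i = 0 then if b then 1 else -1 else 0) + left_shift v"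
  "left_shift (u @ v) = left_shift u + left_shift v"
  by (simp_all add: left_shift_def)

lemma right_shift_simps [simp]:
  "right_shift [] = 0"
  "right_shift ((i, b) # v) = (if b then 1 else -1) + right_shift v"
  "right_shift (u @ v) = right_shift u + right_shift v"
  by (simp_all add: right_shift_def)

lemma right_shift_cong:
  assumes "u \<approx> v"
  shows "right_shift u = right_shift v"
  using assms
  by (induction rule: pres_eq.induct) (auto simp: thompson_relators_def)

text \<open>Adjacent vertices of the Cayley graph therefore never have the same length.\<close>

lemma even_length_cong:
  assumes "u \<approx> v"
  shows "even (length u) \<longleftrightarrow> even (length v)"
  using assms
  by (induction rule: pres_eq.induct) (auto simp: thompson_relators_def)

lemma letter_act_left: "t \<le> 0 \<Longrightarrow> letter_act l t = t + left_shift [l]"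
  by (cases "(l, t)" rule: letter_act.cases) (auto simp: max_def min_def field_simps)

lemma letter_act_right: "fst l \<le> n \<Longrightarrow> t \<ge> real n + 1 \<Longrightarrow> letter_act l t = t + right_shift [l]"
  by (cases "(l, t)" rule: letter_act.cases) (auto simp: max_def min_def field_simps)

text \<open>As long as the point stays to the left of the window, only \<open>x\<^sub>0\<close> can move it.\<close>

lemma word_act_left:
  assumes "\<And>k. k < length w \<Longrightarrow> t + left_shift (take k w) \<le> 0"
  shows "word_act w t = t + left_shift w"
  using assms
proof (induction w rule: rev_induct)
  case (snoc l w)
  have "word_act w t = t + left_shift w"
  proof (rule snoc.IH)
    fix k assume "k < length w"
    then show "t + left_shift (take k w) \<le> 0" using snoc.prems[of k] by simp
  qed
  moreover have "t + left_shift w \<le> 0" using snoc.prems[of "length w"] by simp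
  ultimately show ?case by (simp add: letter_act_left)
qed simp

text \<open>The bound is \<open>n + 1\<close> and not \<open>n\<close> because \<open>x\<^sub>n\<^sup>-\<^sup>1\<close> is a translation only from \<open>n + 1\<close> on.\<close>

lemma word_act_right:
  assumes "fst ` set w \<subseteq> {..n}"
    and "\<And>k. k < length w \<Longrightarrow> t + right_shift (take k w) \<ge> real n + 1"
  shows "word_act w t = t + right_shift w"
  using assms
proof (induction w rule: rev_induct)
  case (snoc l w)
  have "word_act w t = t + right_shift w"
  proof (rule snoc.IH)
    fix k assume "k < length w"
    then show "t + right_shift (take k w) \<ge> real n + 1" using snoc.prems(2)[of k] by simp
  qed (use snoc.prems(1) in auto)
  moreover have "t + right_shift w \<ge> real n + 1" using snoc.prems(2)[of "length w"] by simp
  moreover have "fst l \<le> n" using snoc.prems(1) by simp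
  ultimately show ?case by (simp add: letter_act_right)
qed simp

lemma left_shift_le_length: "\<bar>left_shift w\<bar> \<le> length w"
proof (induction w rule: rev_induct)
  case (snoc l w)
  have "\<bar>left_shift [l]\<bar> \<le> 1" by (cases l; cases "fst l") auto
  then show ?case using snoc by simp
qed simp

section \<open>A lower bound for the length\<close>

text \<open>The lower bounds below come from functions of the prefix that grow by at most 1 per letter.\<close>

lemma lipschitz_length:
  fixes f :: "nat group_word \<Rightarrow> real"
  assumes "\<And>u l. f (u @ [l]) - f u \<le> 1"
  shows "f (u @ v) - f u \<le> length v"
proof (induction v rule: rev_induct)
  case (snoc l v)
  then show ?case using assms[of "u @ v" l] by simp
qed simp

text \<open>The three numbers that describe a prefix are its left shift \<open>p\<close>, the image \<open>c\<close> of 0 and its right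
  shift \<open>q\<close>. A letter \<open>x\<^sub>0\<^sup>\<plusminus>\<^sup>1\<close> moves all three by the same amount. Any other letter keeps \<open>p\<close> and
  spends its single unit on \<open>c - p\<close> (what happens to the left of the image of 0) and \<open>q - c\<close> (what
  happens to the right of it), both in the same direction. It affects the left part only if \<open>c > 0\<close>,
  and then it does not make \<open>c\<close> negative. Below, \<open>t\<close> plays the role of \<open>c\<close>.\<close>

lemma letter_cases:
  fixes l :: "nat \<times> bool" and t :: real
  obtains e where "e \<in> {1, -1}" "left_shift [l] = e" "right_shift [l] = e" "letter_act l t = t + e"
  | e \<theta> where "e \<in> {1, -1}" "left_shift [l] = 0" "right_shift [l] = e"
      "letter_act l t = t + \<theta>" "0 \<le> \<theta> * e" "\<theta> * e \<le> 1" "t \<le> 0 \<Longrightarrow> \<theta> = 0" "t > 0 \<Longrightarrow> t + \<theta> \<ge> 0"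
proof (cases "(l, t)" rule: letter_act.cases)
  case (1 t) then show ?thesis using that(1)[of 1] by simp
next
  case (2 t) then show ?thesis using that(1)[of "-1"] by simp
next
  case (3 j t)
  then show ?thesis
    using that(2)[of 1 "max 0 (min 1 (t - j))"] by (auto simp: max_def min_def)
next
  case (4 j t)
  then show ?thesis
    using that(2)[of "-1" "- max 0 (min 1 ((t - j) / 2))"]
    by (auto simp: max_def min_def field_simps split: if_splits)
qed

text \<open>Here \<open>u\<close> ends where the left shift is large, and \<open>u @ v\<close> where the right shift is very negative.
  The travel along \<open>u\<close>, \<open>v\<close> and \<open>s\<close> is measured by \<open>p - (q - p)\<close>, \<open>- q\<close> and \<open>q\<close>.\<close>

lemma length_lower_bound_left_first:
  assumes "w = u @ v @ s"
  shows "length w \<ge> 2 * left_shift u - 2 * right_shift (u @ v) + right_shift w"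
proof -
  have 1: "(2 * left_shift (x @ [l]) - right_shift (x @ [l])) - (2 * left_shift x - right_shift x) \<le> 1"
    and 2: "- right_shift (x @ [l]) - (- right_shift x) \<le> 1"
    and 3: "right_shift (x @ [l]) - right_shift x \<le> 1" for x l
    by (cases l "0 :: real" rule: letter_cases; auto)+
  show ?thesis
    using lipschitz_length[of "\<lambda>x. 2 * left_shift x - right_shift x" "[]" u, OF 1]
      lipschitz_length[of "\<lambda>x. - right_shift x" u v, OF 2]
      lipschitz_length[of right_shift "u @ v" s, OF 3]
    by (simp add: assms)
qed

text \<open>In this order a word might bring the right end nearer by contracting, with letters other than
  \<open>x\<^sub>0\<close>, the part of the line to the left of 0, and it might never undo this. The potential for the
  first stretch \<open>u\<close> therefore charges \<open>c - p\<close> twice. A single letter can afford this because a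
  contraction on the left needs \<open>c > 0\<close>, and then it lowers the term \<open>2 * max c 0\<close> by as much as it
  raises \<open>- 2 * (c - p)\<close>. Along \<open>v\<close> and \<open>s\<close> the travel is measured by \<open>p - (c - p) + (q - c)\<close> and
  \<open>- p - (c - p) + (q - c)\<close>.\<close>

lemma length_lower_bound_right_first:
  assumes "w = u @ v @ s"
  shows "length w \<ge> 2 * left_shift (u @ v) - 2 * right_shift u + right_shift w - 2 * word_act w 0"
proof -
  define f where "f x = - right_shift x - 2 * (word_act x 0 - left_shift x) + 2 * max (word_act x 0) 0" for x
  define g where "g x = 2 * left_shift x - 2 * word_act x 0 + right_shift x" for x
  define h where "h x = right_shift x - 2 * word_act x 0" for x
  have 1: "f (x @ [l]) - f x \<le> 1" for x l
    by (cases l "word_act x 0" rule: letter_cases) (auto simp: f_def max_def)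
  have 2: "g (x @ [l]) - g x \<le> 1" for x l
    by (cases l "word_act x 0" rule: letter_cases) (auto simp: g_def)
  have 3: "h (x @ [l]) - h x \<le> 1" for x l
    by (cases l "word_act x 0" rule: letter_cases) (auto simp: h_def)
  have "f u - f [] \<le> length u" "g (u @ v) - g u \<le> length v" "h w - h (u @ v) \<le> length s"
    using lipschitz_length[of f "[]" u, OF 1] lipschitz_length[of g u v, OF 2]
      lipschitz_length[of h "u @ v" s, OF 3] by (simp_all add: assms)
  moreover have "max (word_act u 0) 0 \<ge> 0" by simp
  ultimately have "real (length u) + length v + length s
      \<ge> 2 * left_shift (u @ v) - 2 * right_shift u + right_shift w - 2 * word_act w 0"
    by (simp add: f_def g_def h_def)
  then show ?thesis by (simp add: assms)
qed

text \<open>A word that breaks the translation pattern just to the right of \<open>P\<close> has a prefix that carries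
  \<open>P + 1\<close> beyond 0, and if it breaks the pattern to the right of \<open>R\<close>, it has a prefix that carries
  \<open>R\<close> below \<open>n + 1\<close>. The two estimates above apply according to the order of these prefixes.\<close>

lemma length_lower_bound:
  fixes n :: nat and P R :: real
  assumes "fst ` set w \<subseteq> {..n}"
    and left: "word_act w (P + 1) - word_act w P \<noteq> 1"
    and right: "word_act w (R + 1) - word_act w R \<noteq> 1"
    and "word_act w 0 \<ge> 0"
  shows "length w \<ge> 2 * (R - P) - 2 * real n - 4 + right_shift w - 2 * word_act w 0"
proof -
  obtain i where i: "P + 1 + left_shift (take i w) > 0"
  proof (rule ccontr)
    assume "\<not> thesis"
    then have *: "P + 1 + left_shift (take k w) \<le> 0" for k using that[of k] by linarith
    then have "P + left_shift (take k w) \<le> 0" for k using *[of k] by linarith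
    then show False using left word_act_left[of w P] word_act_left[of w "P + 1"] * by simp
  qed
  obtain j where j: "R + right_shift (take j w) < real n + 1"
  proof (rule ccontr)
    assume "\<not> thesis"
    then have *: "R + right_shift (take k w) \<ge> real n + 1" for k using that[of k] by linarith
    have "word_act w (R + 1) = R + 1 + right_shift w"
    proof (rule word_act_right[OF assms(1)])
      show "R + 1 + right_shift (take k w) \<ge> real n + 1" for k using *[of k] by linarith
    qed
    moreover have "word_act w R = R + right_shift w"
      by (rule word_act_right[OF assms(1)]) (rule *)
    ultimately show False using right by simp
  qed
  show ?thesis
  proof (cases "i \<le> j")
    case True
    have t: "take i w @ take (j - i) (drop i w) = take j w"
      using True take_add[of i "j - i" w] by simp
    then have "w = take i w @ take (j - i) (drop i w) @ drop j w"
      by (metis append.assoc append_take_drop_id)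
    from length_lower_bound_left_first[OF this]
    have "length w \<ge> 2 * (R - P) - 2 * real n - 4 + right_shift w"
      unfolding t right_diff_distrib using i j by linarith
    then show ?thesis using assms(4) by linarith
  next
    case False
    have t: "take j w @ take (i - j) (drop j w) = take i w"
      using False take_add[of j "i - j" w] by simp
    then have "w = take j w @ take (i - j) (drop j w) @ drop i w"
      by (metis append.assoc append_take_drop_id)
    from length_lower_bound_right_first[OF this] show ?thesis
      unfolding t right_diff_distrib using i j by linarith
  qed
qed

text \<open>The half-line \<open>[n + 1 + j, \<infinity>)\<close> moves rigidly in unit steps until its end point reaches \<open>n + 1\<close>.\<close>

lemma first_crossing:
  assumes "fst ` set p \<subseteq> {..n}" and "word_act p (real n + 1 + real j) \<le> n + 1"
  shows "\<exists>k. right_shift (take k p) = - real j \<and> 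
             (\<forall>t \<ge> real n + 1 + real j. word_act (take k p) t = t - real j)"
  using assms
proof (induction p arbitrary: j)
  case Nil
  then show ?case by simp
next
  case (Cons l p)
  show ?case
  proof (cases j)
    case 0
    then show ?thesis by (intro exI[of _ 0]) simp
  next
    case (Suc j')
    have l: "letter_act l t = t + right_shift [l]" if "t \<ge> real n + 1 + real j" for t
      using letter_act_right[of l n t] Cons.prems(1) that by simp
    define j2 where "j2 = (if snd l then Suc j else j')"
    have s: "right_shift [l] = real j2 - real j"
      by (cases l) (auto simp: j2_def Suc)
    have "word_act p (real n + 1 + real j2) \<le> n + 1"
      using Cons.prems(2) l[of "real n + 1 + real j"] by (simp add: s add.assoc)
    from Cons.IH[OF _ this] Cons.prems(1)
    obtain k where k: "right_shift (take k p) = - real j2"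
      "\<And>t. t \<ge> real n + 1 + real j2 \<Longrightarrow> word_act (take k p) t = t - real j2" by auto
    have "right_shift (take (Suc k) (l # p)) = right_shift [l] + right_shift (take k p)"
      by (simp add: right_shift_def split: prod.split)
    moreover have "word_act (take (Suc k) (l # p)) t = t - real j" if "t \<ge> real n + 1 + real j" for t
      using k(2)[of "t + right_shift [l]"] that by (simp add: l s)
    ultimately show ?thesis using k(1) s by (intro exI[of _ "Suc k"]) simp
  qed
qed


section \<open>Balls and paths in terms of words\<close>

abbreviation F_class :: "nat group_word \<Rightarrow> nat group_word set" where
  "F_class \<equiv> pres_class thompson_relators"

text \<open>Group elements are handled through words representing them, since the action is defined on words.\<close>

definition ball_words :: "nat set \<Rightarrow> nat \<Rightarrow> nat group_word set" where
  "ball_words I m = {u. \<exists>w. fst ` set w \<subseteq> I \<and> length w \<le> m \<and> w \<approx> u}"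

lemma ball_words_cong: "u \<approx> v \<Longrightarrow> u \<in> ball_words I m \<Longrightarrow> v \<in> ball_words I m"
  unfolding ball_words_def using pres_eq.trans by blast

lemma ball_words_mono: "u \<in> ball_words I m \<Longrightarrow> m \<le> m' \<Longrightarrow> u \<in> ball_words I m'"
  unfolding ball_words_def using order.trans by blast

text \<open>The vertices of the path that starts at \<open>u\<close> and is spelled by \<open>p\<close> are the \<open>u @ take k p\<close>; for
  \<open>k\<close> beyond the length of \<open>p\<close> this is the end point again.\<close>

definition word_path :: "nat set \<Rightarrow> nat group_word set \<Rightarrow> nat group_word \<Rightarrow> nat group_word \<Rightarrow> bool" where
  "word_path I B u p \<longleftrightarrow> fst ` set p \<subseteq> I \<and> (\<forall>k. u @ take k p \<in> B)"

lemma group_F_class: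
  "F_class u \<otimes>\<^bsub>thompson_F\<^esub> F_class v = F_class (u @ v)"
  "\<one>\<^bsub>thompson_F\<^esub> = F_class []"
  "F_class u \<in> carrier thompson_F"
  by (simp_all add: thompson_F_def pres_one pres_carrier)

lemma sym_gens_thompson:
  "sym_gens thompson_F (thompson_x ` I) = {F_class [(i, b)] | i b. i \<in> I}"
proof -
  have "inv\<^bsub>thompson_F\<^esub> (thompson_x i) = F_class [(i, False)]" for i
    by (simp add: thompson_F_def thompson_x_def pres_inv inv_word_def)
  then have "sym_gens thompson_F (thompson_x ` I)
      = (\<lambda>i. F_class [(i, True)]) ` I \<union> (\<lambda>i. F_class [(i, False)]) ` I"
    unfolding sym_gens_def image_image thompson_x_def by simp
  also have "\<dots> = {F_class [(i, b)] | i b. i \<in> I}"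
    unfolding ex_bool_eq by blast
  finally show ?thesis .
qed

lemma list_product_letters:
  "list_product thompson_F (map (\<lambda>l. F_class [l]) w) = F_class w"
  by (induction w) (simp_all add: list_product_def group_F_class)

lemma list_product_iff_word:
  "(\<exists>ws. length ws = k \<and> set ws \<subseteq> sym_gens thompson_F (thompson_x ` I) \<and>
         g = list_product thompson_F ws)
   \<longleftrightarrow> (\<exists>w. fst ` set w \<subseteq> I \<and> length w = k \<and> g = F_class w)" (is "?L \<longleftrightarrow> ?R")
proof
  assume ?L
  then obtain ws where ws: "length ws = k" "set ws \<subseteq> sym_gens thompson_F (thompson_x ` I)"
    "g = list_product thompson_F ws" by blast
  have "\<exists>w. ws = map (\<lambda>l. F_class [l]) w \<and> fst ` set w \<subseteq> I"
    using ws(2)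
  proof (induction ws)
    case (Cons a ws)
    then obtain w i b where "ws = map (\<lambda>l. F_class [l]) w" "fst ` set w \<subseteq> I"
      "a = F_class [(i, b)]" "i \<in> I"
      by (auto simp: sym_gens_thompson)
    then show ?case by (intro exI[of _ "(i, b) # w"]) simp
  qed simp
  then obtain w where "ws = map (\<lambda>l. F_class [l]) w" "fst ` set w \<subseteq> I" by blast
  then show ?R using ws(1,3) by (intro exI[of _ w]) (simp add: list_product_letters)
next
  assume ?R
  then obtain w where w: "fst ` set w \<subseteq> I" "length w = k" "g = F_class w" by blast
  have "F_class [l] \<in> sym_gens thompson_F (thompson_x ` I)" if "l \<in> set w" for l
    using w(1) that unfolding sym_gens_thompson by (cases l) force
  then show ?L
    using w(2,3)
    by (intro exI[of _ "map (\<lambda>l. F_class [l]) w"]) (auto simp: list_product_letters)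
qed

lemma word_dist_F_class:
  "word_dist thompson_F (thompson_x ` I) (F_class u) (F_class v)
     = (LEAST k. \<exists>w. fst ` set w \<subseteq> I \<and> length w = k \<and> u @ w \<approx> v)"
proof -
  interpret group thompson_F by (rule group_thompson_F)
  have "inv\<^bsub>thompson_F\<^esub> F_class u \<otimes>\<^bsub>thompson_F\<^esub> F_class v = F_class w \<longleftrightarrow> u @ w \<approx> v" for w
    using inv_solve_left'[OF group_F_class(3) group_F_class(3) group_F_class(3), of u v w]
    unfolding group_F_class(1) pres_class_eq_iff using pres_eq.sym by blast
  then show ?thesis by (simp add: word_dist_def list_product_iff_word)
qed

lemma generated_by_words:
  assumes "generate thompson_F (thompson_x ` I) = carrier thompson_F"
  obtains w where "fst ` set w \<subseteq> I" "w \<approx> u"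
proof -
  have "\<exists>w. fst ` set w \<subseteq> I \<and> g = F_class w"
    if "g \<in> generate thompson_F (thompson_x ` I)" for g
    using that
  proof (induction rule: generate.induct)
    case one
    show ?case by (intro exI[of _ "[]"]) (simp add: group_F_class)
  next
    case (incl h)
    then obtain i where "i \<in> I" "h = thompson_x i" by blast
    then show ?case by (intro exI[of _ "[(i, True)]"]) (simp add: thompson_x_def)
  next
    case (inv h)
    then obtain i where "i \<in> I" "h = thompson_x i" by blast
    then show ?case
      by (intro exI[of _ "[(i, False)]"])
        (simp add: thompson_x_def thompson_F_def pres_inv inv_word_def)
  next
    case (eng h1 h2)
    then obtain w1 w2 where "fst ` set w1 \<subseteq> I" "h1 = F_class w1" "fst ` set w2 \<subseteq> I" "h2 = F_class w2"
      by blast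
    then show ?case by (intro exI[of _ "w1 @ w2"]) (simp add: group_F_class image_Un)
  qed
  from this[of "F_class u"] obtain w where "fst ` set w \<subseteq> I" "F_class u = F_class w"
    unfolding assms using group_F_class(3) by blast
  then show ?thesis using that pres_eq.sym unfolding pres_class_eq_iff by blast
qed

lemma word_ball_iff:
  assumes "generate thompson_F (thompson_x ` I) = carrier thompson_F"
  shows "F_class u \<in> word_ball thompson_F (thompson_x ` I) m \<longleftrightarrow> u \<in> ball_words I m"
proof -
  define P where "P k \<longleftrightarrow> (\<exists>w. fst ` set w \<subseteq> I \<and> length w = k \<and> w \<approx> u)" for k
  obtain w where "fst ` set w \<subseteq> I" "w \<approx> u" by (rule generated_by_words[OF assms])
  then have "P (length w)" unfolding P_def by blast
  then have least: "P (LEAST k. P k)" by (rule LeastI)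
  have "word_dist thompson_F (thompson_x ` I) (F_class []) (F_class u) = (LEAST k. P k)"
    unfolding word_dist_F_class P_def by simp
  moreover have "u \<in> ball_words I m \<longleftrightarrow> (\<exists>k\<le>m. P k)"
    unfolding ball_words_def P_def by blast
  moreover have "(\<exists>k\<le>m. P k) \<longleftrightarrow> (LEAST k. P k) \<le> m"
    using least Least_le[of P] order.trans by metis
  ultimately show ?thesis
    unfolding word_ball_def mem_Collect_eq group_F_class(2) by (simp add: group_F_class(3))
qed

lemma cayley_path_word:
  assumes "generate thompson_F (thompson_x ` I) = carrier thompson_F"
    and "cayley_path thompson_F (thompson_x ` I) (F_class u) P g"
    and "set P \<subseteq> word_ball thompson_F (thompson_x ` I) m"
  shows "\<exists>p. length p = path_length P \<and> word_path I (ball_words I m) u p \<and> g = F_class (u @ p)"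
  using assms(2,3)
proof (induction P arbitrary: u)
  case Nil
  then show ?case by (simp add: cayley_path_def)
next
  case (Cons h P)
  have h: "h = F_class u" using Cons.prems(1) by (simp add: cayley_path_def)
  have u: "u \<in> ball_words I m"
    using Cons.prems(2) word_ball_iff[OF assms(1), of u m] by (simp add: h)
  show ?case
  proof (cases P)
    case Nil
    then show ?thesis
      using Cons.prems(1) u h
      by (intro exI[of _ "[]"]) (auto simp: cayley_path_def word_path_def path_length_def)
  next
    case (Cons h' P')
    have "cayley_adj thompson_F (thompson_x ` I) h h'"
      using Cons.prems(1) by (auto simp: Cons cayley_path_def)
    then obtain i b where ib: "i \<in> I" "h' = F_class (u @ [(i, b)])"
      by (auto simp: cayley_adj_def sym_gens_thompson h group_F_class)
    have "cayley_path thompson_F (thompson_x ` I) (F_class (u @ [(i, b)])) P g"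
      using Cons.prems(1) ib(2) by (simp add: Cons cayley_path_def)
    with Cons.IH[OF this] Cons.prems(2) obtain p where
      p: "length p = path_length P" "word_path I (ball_words I m) (u @ [(i, b)]) p"
      "g = F_class ((u @ [(i, b)]) @ p)" by auto
    have "u @ take k ((i, b) # p) \<in> ball_words I m" for k
      using p(2) u by (cases k) (simp_all add: word_path_def)
    then show ?thesis
      using p ib(1) Cons by (intro exI[of _ "(i, b) # p"]) (simp add: word_path_def path_length_def)
  qed
qed

text \<open>The constant can be taken to be at least 1, so that replacing a piece of a path by a path of length
  at most \<open>L\<close> costs a factor \<open>L\<close> also for pieces of a single edge.\<close>

lemma almost_convex_words:
  assumes gen: "generate thompson_F (thompson_x ` I) = carrier thompson_F"
    and "almost_convex thompson_F (thompson_x ` I)"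
  obtains L where "L \<ge> 1"
    "\<And>m u s. m > 0 \<Longrightarrow> fst ` set s \<subseteq> I \<Longrightarrow> length s \<le> 2 \<Longrightarrow> u \<in> ball_words I m \<Longrightarrow>
       u @ s \<in> ball_words I m \<Longrightarrow>
       \<exists>p. length p \<le> L \<and> word_path I (ball_words I m) u p \<and> u @ p \<approx> u @ s"
proof -
  let ?X = "thompson_x ` I"
  obtain L where L: "\<And>m x y. m > 0 \<Longrightarrow> x \<in> word_ball thompson_F ?X m \<Longrightarrow>
      y \<in> word_ball thompson_F ?X m \<Longrightarrow> word_dist thompson_F ?X x y \<le> 2 \<Longrightarrow>
      \<exists>p. cayley_path thompson_F ?X x p y \<and> path_length p \<le> L \<and> set p \<subseteq> word_ball thompson_F ?X m"
    using assms(2) unfolding almost_convex_def by blast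
  show thesis
  proof (rule that[of "Suc L"])
    fix m u s
    assume *: "m > (0::nat)" "fst ` set s \<subseteq> I" "length s \<le> 2" "u \<in> ball_words I m"
      "u @ s \<in> ball_words I m"
    have "word_dist thompson_F ?X (F_class u) (F_class (u @ s)) \<le> length s"
      unfolding word_dist_F_class by (rule Least_le) (use *(2) pres_eq.refl in blast)
    then obtain P where P: "cayley_path thompson_F ?X (F_class u) P (F_class (u @ s))"
      "path_length P \<le> L" "set P \<subseteq> word_ball thompson_F ?X m"
      using L[of m "F_class u" "F_class (u @ s)"] * by (auto simp: word_ball_iff[OF gen])
    from cayley_path_word[OF gen P(1,3)] obtain p where
      "length p = path_length P" "word_path I (ball_words I m) u p" "u @ p \<approx> u @ s"
      unfolding pres_class_eq_iff using pres_eq.sym by blast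
    then show "\<exists>p. length p \<le> Suc L \<and> word_path I (ball_words I m) u p \<and> u @ p \<approx> u @ s"
      using P(2) by (intro exI[of _ p]) simp
  qed simp
qed

section \<open>Almost convexity at larger distances\<close>

lemma ball_words_parity:
  assumes "u \<in> ball_words I (Suc m)" "v \<in> ball_words I (Suc m)"
    and "u \<notin> ball_words I m" "odd (length u + length v)"
  shows "v \<in> ball_words I m"
proof -
  obtain w w' where w: "fst ` set w \<subseteq> I" "length w \<le> Suc m" "w \<approx> u"
    and w': "fst ` set w' \<subseteq> I" "length w' \<le> Suc m" "w' \<approx> v"
    using assms(1,2) unfolding ball_words_def by blast
  have "\<not> length w \<le> m" using w assms(3) unfolding ball_words_def by blast
  then have "length w = Suc m" using w(2) by simp
  moreover have "odd (length w + length w')"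
    using even_length_cong[OF w(3)] even_length_cong[OF w'(3)] assms(4) by simp
  ultimately have "length w' \<noteq> Suc m" by auto
  then show ?thesis using w' unfolding ball_words_def by force
qed

lemma word_path_append:
  assumes "word_path I (ball_words I m) u p" "word_path I (ball_words I m) v q" "u @ p \<approx> v"
  shows "word_path I (ball_words I m) u (p @ q)"
proof -
  have "u @ take k (p @ q) \<in> ball_words I m" for k
  proof (cases "k \<le> length p")
    case True
    then show ?thesis using assms(1) by (simp add: word_path_def)
  next
    case False
    have "v @ take (k - length p) q \<approx> (u @ p) @ take (k - length p) q"
      by (intro pres_eq_append pres_eq.refl pres_eq.sym[OF assms(3)])
    moreover have "v @ take (k - length p) q \<in> ball_words I m"
      using assms(2) by (simp add: word_path_def)
    ultimately show ?thesis using False ball_words_cong by force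
  qed
  then show ?thesis using assms(1,2) by (simp add: word_path_def image_Un)
qed

text \<open>By parity two consecutive vertices never both lie outside the smaller ball. So each vertex outside
  it lies between two vertices inside, at distance at most 2, and almost convexity supplies a detour
  around it. The induction cuts off one edge, or the two edges at an outer vertex, at a time.\<close>

lemma push_path_down:
  assumes "L \<ge> 1" "m > 0"
    and AC: "\<And>u s. fst ` set s \<subseteq> I \<Longrightarrow> length s \<le> 2 \<Longrightarrow> u \<in> ball_words I m \<Longrightarrow>
       u @ s \<in> ball_words I m \<Longrightarrow>
       \<exists>p. length p \<le> L \<and> word_path I (ball_words I m) u p \<and> u @ p \<approx> u @ s"
    and "word_path I (ball_words I (Suc m)) u p" "u \<in> ball_words I m" "u @ p \<in> ball_words I m"
  shows "\<exists>q. length q \<le> L * length p \<and> word_path I (ball_words I m) u q \<and> u @ q \<approx> u @ p"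
  using assms(4-6)
proof (induction "length p" arbitrary: u p rule: less_induct)
  case less
  \<comment> \<open>Replace an initial piece \<open>s\<close> whose end point lies in the smaller ball, then continue from there.\<close>
  have step: "\<exists>q. length q \<le> L * length p \<and> word_path I (ball_words I m) u q \<and> u @ q \<approx> u @ p"
    if p: "p = s @ p'" "s \<noteq> []" "length s \<le> 2" and s: "u @ s \<in> ball_words I m" for s p'
  proof -
    have "fst ` set s \<subseteq> I" using less.prems(1) p(1) by (auto simp: word_path_def)
    then obtain r where r: "length r \<le> L" "word_path I (ball_words I m) u r" "u @ r \<approx> u @ s"
      using AC[of s u] p(3) less.prems(2) s by blast
    have "word_path I (ball_words I (Suc m)) (u @ s) p'"
      unfolding word_path_def
    proof safe
      fix k
      show "(u @ s) @ take k p' \<in> ball_words I (Suc m)"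
        using less.prems(1) unfolding word_path_def
        by (auto simp: p(1) dest!: spec[of _ "length s + k"])
    qed (use less.prems(1) p(1) in \<open>auto simp: word_path_def\<close>)
    moreover have "length p' < length p" using p by (cases s) auto
    ultimately obtain q where q: "length q \<le> L * length p'"
      "word_path I (ball_words I m) (u @ s) q" "(u @ s) @ q \<approx> (u @ s) @ p'"
      using less.hyps[of p' "u @ s"] s less.prems(3) p(1) by auto
    have "word_path I (ball_words I m) u (r @ q)"
      by (rule word_path_append[OF r(2) q(2) r(3)])
    moreover have "u @ r @ q \<approx> u @ p"
      using pres_eq.trans[OF pres_eq_append[OF r(3) pres_eq.refl[of _ q]]] q(3) by (simp add: p(1))
    moreover have "length s \<ge> 1" using p(2) by (cases s) auto
    then have "L * 1 \<le> L * length s" by (rule mult_le_mono2)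
    then have "length r + length q \<le> L * length s + L * length p'" using r(1) q(1) by linarith
    then have "length (r @ q) \<le> L * length p" by (simp add: p(1) distrib_left)
    ultimately show ?thesis by blast
  qed
  show ?case
  proof (cases p)
    case Nil
    then show ?thesis
      using less.prems(2) by (intro exI[of _ "[]"]) (simp add: word_path_def pres_eq.refl)
  next
    case p: (Cons l p')
    show ?thesis
    proof (cases "u @ [l] \<in> ball_words I m")
      case True
      then show ?thesis using step[of "[l]" p'] p by simp
    next
      case False
      then have "p' \<noteq> []" using less.prems(3) p by auto
      then obtain l' p'' where p': "p' = l' # p''" by (cases p') auto
      have "u @ take 1 p \<in> ball_words I (Suc m)" "u @ take 2 p \<in> ball_words I (Suc m)"
        using less.prems(1) unfolding word_path_def by blast+
      then have "u @ [l, l'] \<in> ball_words I m"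
        using ball_words_parity[of "u @ [l]" I m "u @ [l, l']"] False by (simp add: p p')
      then show ?thesis using step[of "[l, l']" p''] p p' by simp
    qed
  qed
qed

lemma almost_convex_far:
  assumes "L \<ge> 1" "m > 0"
    and AC: "\<And>m u s. m > 0 \<Longrightarrow> fst ` set s \<subseteq> I \<Longrightarrow> length s \<le> 2 \<Longrightarrow> u \<in> ball_words I m \<Longrightarrow>
       u @ s \<in> ball_words I m \<Longrightarrow>
       \<exists>p. length p \<le> L \<and> word_path I (ball_words I m) u p \<and> u @ p \<approx> u @ s"
    and "word_path I (ball_words I (m + j)) u p" "u \<in> ball_words I m" "u @ p \<in> ball_words I m"
  shows "\<exists>q. length q \<le> L ^ j * length p \<and> word_path I (ball_words I m) u q \<and> u @ q \<approx> u @ p"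
  using assms(4-6)
proof (induction j arbitrary: p)
  case 0
  then show ?case by (intro exI[of _ p]) (simp add: pres_eq.refl)
next
  case (Suc j)
  have "\<exists>q. length q \<le> L * length p \<and> word_path I (ball_words I (m + j)) u q \<and> u @ q \<approx> u @ p"
    using Suc.prems assms(1,2)
    by (intro push_path_down AC) (auto intro: ball_words_mono)
  then obtain q where q: "length q \<le> L * length p" "word_path I (ball_words I (m + j)) u q"
    "u @ q \<approx> u @ p" by blast
  have "u @ q \<in> ball_words I m" using ball_words_cong[OF pres_eq.sym[OF q(3)]] Suc.prems(3) by blast
  from Suc.IH[OF q(2) Suc.prems(2) this]
  obtain q' where q': "length q' \<le> L ^ j * length q" "word_path I (ball_words I m) u q'"
    "u @ q' \<approx> u @ q" by blast
  have "L ^ j * length q \<le> L ^ j * (L * length p)" using q(1) by (rule mult_le_mono2)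
  with q'(1) have "length q' \<le> L ^ j * (L * length p)" by (rule order.trans)
  then have "length q' \<le> L ^ Suc j * length p" by (simp add: mult.assoc mult.left_commute)
  then show ?case using q'(2) pres_eq.trans[OF q'(3) q(3)] by blast
qed

section \<open>Two tours of the line\<close>

abbreviation x0_power :: "nat \<Rightarrow> bool \<Rightarrow> nat group_word" where
  "x0_power k b \<equiv> replicate k (0, b)"

lemma F_eq_relation: "i < j \<Longrightarrow> [(i, False), (j, True), (i, True)] \<approx> [(Suc j, True)]"
  using thompson_relation[of i j]
  by (simp add: thompson_F_def thompson_x_def pres_inv inv_word_def pres_class_eq_iff)

lemma F_eq_commute:
  assumes "i < j"
  shows "[(j, True), (i, True)] \<approx> [(i, True), (Suc j, True)]"
proof -
  have "[(i, True), (i, False), (j, True), (i, True)] \<approx> [(j, True), (i, True)]"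
    using pres_eq.cancel[of _ "[]" i True] by simp
  moreover have "[(i, True), (i, False), (j, True), (i, True)] \<approx> [(i, True), (Suc j, True)]"
    using pres_eq_context[OF F_eq_relation[OF assms], of "[(i, True)]" "[]"] by simp
  ultimately show ?thesis using pres_eq.sym pres_eq.trans by blast
qed

lemma x0_power_cancel: "x0_power k b @ x0_power k (\<not> b) \<approx> []"
proof (induction k)
  case 0
  show ?case by (simp add: pres_eq.refl)
next
  case (Suc k)
  have "x0_power k b @ [(0, b), (0, \<not> b)] @ x0_power k (\<not> b) \<approx> x0_power k b @ x0_power k (\<not> b)"
    by (rule pres_eq.cancel)
  moreover have "x0_power (Suc k) b @ x0_power (Suc k) (\<not> b)
      = x0_power k b @ [(0, b), (0, \<not> b)] @ x0_power k (\<not> b)"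
    by (simp add: replicate_app_Cons_same)
  ultimately show ?case using Suc by (simp only: pres_eq.trans)
qed

lemma F_eq_conjugate:
  assumes "a > 0"
  shows "x0_power k False @ [(a, True)] @ x0_power k True \<approx> [(a + k, True)]"
proof (induction k)
  case 0
  show ?case by (simp add: pres_eq.refl)
next
  case (Suc k)
  have "[(0, False)] @ (x0_power k False @ [(a, True)] @ x0_power k True) @ [(0, True)]
      \<approx> [(0, False)] @ [(a + k, True)] @ [(0, True)]"
    by (rule pres_eq_context[OF Suc])
  moreover have "[(0, False)] @ [(a + k, True)] @ [(0, True)] \<approx> [(a + Suc k, True)]"
    using F_eq_relation[of 0 "a + k"] assms by simp
  moreover have "x0_power (Suc k) False @ [(a, True)] @ x0_power (Suc k) True
      = [(0, False)] @ (x0_power k False @ [(a, True)] @ x0_power k True) @ [(0, True)]"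
    by (simp add: replicate_append_same)
  ultimately show ?case by (simp only: pres_eq.trans)
qed

text \<open>With \<open>g = x\<^sub>0\<^sup>-\<^sup>D x\<^sub>a x\<^sub>0\<^sup>D\<^sup>+\<^sup>N x\<^sub>a x\<^sub>0\<^sup>-\<^sup>N\<close> these words represent \<open>g x\<^sub>0\<^sup>H\<close> and \<open>g x\<^sub>0\<^sup>-\<^sup>H\<close>. Each
  saves \<open>H\<close> letters at the end, because the direction in which it returns from its second excursion
  agrees with the offset.\<close>

definition right_first_tour :: "nat \<Rightarrow> nat \<Rightarrow> nat \<Rightarrow> nat \<Rightarrow> nat group_word" where
  "right_first_tour a N D H =
     x0_power D False @ [(a, True)] @ x0_power (D + N) True @ [(a, True)] @ x0_power (N - H) False"

definition left_first_tour :: "nat \<Rightarrow> nat \<Rightarrow> nat \<Rightarrow> nat \<Rightarrow> nat group_word" where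
  "left_first_tour a N D H =
     x0_power N True @ [(a, True)] @ x0_power (N + D + 1) False @ [(a, True)] @ x0_power (D + 1 - H) True"

text \<open>The excursion to the right and the excursion to the left are conjugates of \<open>x\<^sub>a\<close> by powers of \<open>x\<^sub>0\<close>.
  Conjugated by \<open>x\<^sub>0\<^sup>N\<close> they become \<open>x\<^sub>a\<^sub>+\<^sub>N\<^sub>+\<^sub>D\<close> and \<open>x\<^sub>a\<close>, and the defining relation exchanges these
  at the price of raising the larger index by 1. This is why the second tour goes to \<open>D + 1\<close>.\<close>

lemma tours_differ_by_x0_power:
  assumes "a > 0" "H \<le> N" "H \<le> D" "N > 0"
  shows "right_first_tour a N D H @ x0_power (2 * H) False \<approx> left_first_tour a N D H"
proof -
  let ?A = "[(a, True)]"
  let ?u = "right_first_tour a N D H @ x0_power (2 * H) False"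
  let ?v = "x0_power N True @ [(a + (N + D), True), (a, True)] @ x0_power (N + H) False"
  let ?w = "x0_power N True @ [(a, True), (Suc (a + (N + D)), True)] @ x0_power (N + H) False"
  have 1: "x0_power N True @ x0_power N False @ ?u \<approx> ?u"
    using pres_eq_append[OF x0_power_cancel[of N True] pres_eq.refl[of _ ?u]] by simp
  have 2: "x0_power N True @ x0_power N False @ ?u
      = x0_power N True @ (x0_power (N + D) False @ ?A @ x0_power (N + D) True) @ ?A
        @ x0_power (N + H) False"
  proof -
    have "x0_power (N - H) False @ x0_power (2 * H) False = x0_power (N + H) False"
      using assms(2) by (simp add: replicate_add[symmetric])
    then show ?thesis
      by (simp add: right_first_tour_def replicate_add add.commute[of D N])
  qed
  have 3: "x0_power N True @ (x0_power (N + D) False @ ?A @ x0_power (N + D) True) @ ?A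
        @ x0_power (N + H) False \<approx> ?v"
    using pres_eq_context[OF F_eq_conjugate[OF assms(1)], of "x0_power N True" "N + D"
        "?A @ x0_power (N + H) False"]
    by simp
  have 4: "?v \<approx> ?w"
    by (rule pres_eq_context[OF F_eq_commute]) (use assms(4) in simp)
  have 5: "x0_power N True @ ?A @ (x0_power (N + D + 1) False @ ?A @ x0_power (N + D + 1) True)
        @ x0_power (N + H) False \<approx> ?w"
    using pres_eq_context[OF F_eq_conjugate[OF assms(1)], of "x0_power N True @ ?A" "N + D + 1"
        "x0_power (N + H) False"]
    by simp
  have 6: "x0_power N True @ ?A @ (x0_power (N + D + 1) False @ ?A @ x0_power (N + D + 1) True)
        @ x0_power (N + H) False
      = left_first_tour a N D H @ x0_power (N + H) True @ x0_power (N + H) False"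
  proof -
    have "x0_power (N + D + 1) True = x0_power (D + 1 - H) True @ x0_power (N + H) True"
      using assms(3) by (simp add: replicate_add[symmetric] del: replicate_Suc)
    then show ?thesis by (simp add: left_first_tour_def del: replicate_Suc)
  qed
  have 7: "left_first_tour a N D H @ x0_power (N + H) True @ x0_power (N + H) False
      \<approx> left_first_tour a N D H"
    using pres_eq_append[OF pres_eq.refl x0_power_cancel[of "N + H" True], of "left_first_tour a N D H"]
    by simp
  have "?u \<approx> ?v" by (rule pres_eq.trans[OF pres_eq.sym[OF 1, unfolded 2] 3])
  moreover have "?w \<approx> left_first_tour a N D H"
    by (rule pres_eq.trans[OF pres_eq.sym[OF 5, unfolded 6] 7])
  ultimately show ?thesis using pres_eq.trans 4 by blast
qed

lemma x0_funpow [simp]: "(letter_act (0, b) ^^ k) t = (if b then t + real k else t - real k)"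
  by (induction k arbitrary: t; cases b) auto

lemma right_shift_x0_power [simp]: "right_shift (x0_power k b) = (if b then real k else - real k)"
  by (induction k) auto

lemma word_act_right_first_tour:
  assumes "a > 0" "H \<le> N" "a < N" "-1 \<le> t"
  shows "t \<le> real D + a - 1 \<Longrightarrow> word_act (right_first_tour a N D H) t = t + 1 + H"
    and "t \<ge> real D + a \<Longrightarrow> word_act (right_first_tour a N D H) t = t + 2 + H"
proof -
  obtain a' where a: "a = Suc a'" using assms(1) by (cases a) auto
  show "t \<le> real D + a - 1 \<Longrightarrow> word_act (right_first_tour a N D H) t = t + 1 + H"
    "t \<ge> real D + a \<Longrightarrow> word_act (right_first_tour a N D H) t = t + 2 + H"
    using assms by (auto simp: right_first_tour_def a max_def min_def of_nat_diff)
qed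

lemma word_act_right_first_tour_left:
  assumes "a > 0" "H \<le> N" "N > 0"
  shows "word_act (right_first_tour a N D H) (real a - 1 - N) = real a - 1 - N + H"
    and "word_act (right_first_tour a N D H) (real a - N) = real a - N + 1 + H"
proof -
  obtain a' where a: "a = Suc a'" using assms(1) by (cases a) auto
  show "word_act (right_first_tour a N D H) (real a - 1 - N) = real a - 1 - N + H"
    "word_act (right_first_tour a N D H) (real a - N) = real a - N + 1 + H"
    using assms by (auto simp: right_first_tour_def a max_def min_def of_nat_diff)
qed

text \<open>A path between the tours has to bring the image of the half-line \<open>[-1, \<infinity>)\<close> from \<open>[H, \<infinity>)\<close> to
  \<open>[-H, \<infinity>)\<close>, so it crosses a vertex at which this image is \<open>[n + 1, \<infinity>)\<close>. There \<open>N\<close> has to be large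
  compared with the path, which may do anything to the points to the left of the half-line that it
  can reach, while \<open>D\<close> only has to be large compared with \<open>n\<close>, since the half-line is moved
  rigidly.\<close>

lemma no_short_path_between_tours:
  assumes I: "I \<subseteq> {..n}" and a: "a \<in> I" "a > 0"
    and H: "H = 3 * n + 10" and N: "N \<ge> length p + H + n + 1" and D: "D \<ge> H"
    and p: "word_path I (ball_words I (2 * N + 2 * D + 4 - H)) (right_first_tour a N D H) p"
    and tours: "right_first_tour a N D H @ p \<approx> left_first_tour a N D H"
  shows False
proof -
  let ?x = "right_first_tour a N D H"
  have "a \<le> n" using I a(1) by auto
  obtain a' where a': "a = Suc a'" using a(2) by (cases a) auto
  define j where "j = H - n - 1"
  have j: "real n + 1 + real j = real H" using H by (simp add: j_def of_nat_diff)
  have p_letters: "fst ` set p \<subseteq> I" using p by (simp add: word_path_def)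
  \<comment> \<open>The left end point of the half-line starts at \<open>H\<close> and ends at \<open>- H\<close>.\<close>
  have "word_act p H = word_act (?x @ p) (-1)"
    using word_act_right_first_tour(1)[of a H N "-1" D] a N \<open>a \<le> n\<close> by simp
  also have "\<dots> = word_act (left_first_tour a N D H) (-1)" by (simp only: word_act_cong[OF tours])
  also have "\<dots> = - real H"
    using D N \<open>a \<le> n\<close> by (simp add: left_first_tour_def a' max_def min_def of_nat_diff)
  finally have "word_act p (real n + 1 + real j) \<le> n + 1" by (simp add: j)
  from first_crossing[OF order.trans[OF p_letters I] this]
  obtain k where k: "right_shift (take k p) = - real j"
    and crossing: "\<forall>t \<ge> real n + 1 + real j. word_act (take k p) t = t - real j"
    by (elim exE conjE)
  have k_act: "word_act (take k p) t = t - real j" if "t \<ge> real H" for t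
    using crossing that unfolding j by simp
  obtain w where w: "fst ` set w \<subseteq> I" "length w \<le> 2 * N + 2 * D + 4 - H" "w \<approx> ?x @ take k p"
    using p unfolding word_path_def ball_words_def by blast
  have act: "word_act w t = word_act (take k p) (word_act ?x t)" for t
    using word_act_cong[OF w(3)] by simp
  have "word_act w 0 = n + 2"
    using word_act_right_first_tour(1)[of a H N 0 D] k_act[of "1 + H"] a N \<open>a \<le> n\<close> j
    by (simp add: act)
  \<comment> \<open>The letter \<open>x\<^sub>a\<close> breaks the translation pattern on \<open>[a - 1, a]\<close>, which the two excursions
    apply at \<open>[R, R + 1]\<close> and \<open>[P, P + 1]\<close>.\<close>
  define R where "R = real D + a - 1"
  define P where "P = real a - 1 - N"
  have "word_act ?x R = R + 1 + H" "word_act ?x (R + 1) = R + 1 + 2 + H"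
    using word_act_right_first_tour[of a H N R D] word_act_right_first_tour(2)[of a H N "R + 1" D]
      a N \<open>a \<le> n\<close> by (simp_all add: R_def)
  then have "word_act w (R + 1) - word_act w R = 2"
    using k_act[of "R + 1 + H"] k_act[of "R + 1 + 2 + H"] a(2) by (simp add: act R_def)
  have "word_act ?x P = P + H" "word_act ?x (P + 1) = P + 2 + H"
    using word_act_right_first_tour_left[of a H N D] a N by (simp_all add: P_def)
  \<comment> \<open>The path is too short to carry points near \<open>P\<close> into the window, so it only translates them.\<close>
  moreover have "word_act (take k p) t = t + left_shift (take k p)" if "t \<le> - real (length p)" for t
  proof (rule word_act_left)
    fix i
    have "left_shift (take i (take k p)) \<le> length p"
      using left_shift_le_length[of "take i (take k p)"] by simp
    then show "t + left_shift (take i (take k p)) \<le> 0" using that by simp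
  qed
  moreover have "P + 2 + H \<le> - real (length p)"
    using N \<open>a \<le> n\<close> by (simp add: P_def)
  ultimately have "word_act w (P + 1) - word_act w P = 2" by (simp add: act)
  have "right_shift w = n + 3"
    using right_shift_cong[OF w(3)] k j N by (simp add: right_first_tour_def of_nat_diff)
  have "length w \<ge> 2 * (R - P) - 2 * real n - 4 + right_shift w - 2 * word_act w 0"
    using w(1) I \<open>word_act w 0 = n + 2\<close> \<open>word_act w (R + 1) - word_act w R = 2\<close>
      \<open>word_act w (P + 1) - word_act w P = 2\<close>
    by (intro length_lower_bound) auto
  then have "real (length w) \<ge> 2 * real N + 2 * real D - 3 * real n - 5"
    by (simp add: \<open>word_act w 0 = n + 2\<close> \<open>right_shift w = n + 3\<close> R_def P_def)
  moreover have "length w + 3 * n + 6 \<le> 2 * N + 2 * D"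
    using w(2) H N by linarith
  ultimately show False by linarith
qed

text \<open>Used to see that \<open>x\<^sub>0\<close> alone does not generate the group.\<close>

lemma word_act_powers_of_x0:
  "fst ` set w \<subseteq> {0} \<Longrightarrow> word_act w t = t + left_shift w"
proof (induction w arbitrary: t)
  case (Cons l w)
  then show ?case by (cases "(l, t)" rule: letter_act.cases) auto
qed simp

theorem theorem4p4:
  fixes X :: "nat group_word set set"
  assumes "X \<subseteq> range thompson_x"
    and "finite X"
    and "thompson_x 0 \<in> X"
    and "generate thompson_F X = carrier thompson_F"
  shows "\<not> almost_convex thompson_F X"
proof
  assume "almost_convex thompson_F X"
  obtain J where J: "finite J" "X = thompson_x ` J"
    using finite_subset_image[OF assms(2,1)] by blast
  define I where "I = insert 0 J"
  have I: "finite I" "0 \<in> I" "X = thompson_x ` I" using J assms(3) by (auto simp: I_def)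
  define n where "n = Max I"
  have n: "I \<subseteq> {..n}" using I(1) by (auto simp: n_def)
  have gen: "generate thompson_F (thompson_x ` I) = carrier thompson_F"
    using assms(4) I(3) by simp
  obtain a where a: "a \<in> I" "a > 0"
  proof (rule ccontr)
    assume "\<not> thesis"
    then have "I \<subseteq> {0}" using that by blast
    moreover obtain w where w: "fst ` set w \<subseteq> I" "w \<approx> [(1, True)]"
      by (rule generated_by_words[OF gen])
    ultimately have "word_act w 1 - word_act w 0 = 1" by (simp add: word_act_powers_of_x0)
    then show False by (simp add: word_act_cong[OF w(2)])
  qed
  obtain L where L: "L \<ge> 1"
    "\<And>m u s. m > 0 \<Longrightarrow> fst ` set s \<subseteq> I \<Longrightarrow> length s \<le> 2 \<Longrightarrow> u \<in> ball_words I m \<Longrightarrow>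
       u @ s \<in> ball_words I m \<Longrightarrow>
       \<exists>p. length p \<le> L \<and> word_path I (ball_words I m) u p \<and> u @ p \<approx> u @ s"
    using \<open>almost_convex thompson_F X\<close> unfolding I(3) by (rule almost_convex_words[OF gen]) blast
  define H where "H = 3 * n + 10"
  \<comment> \<open>The first summand bounds the length of the path that almost convexity will provide.\<close>
  define N where "N = L ^ (2 * H) * (2 * H) + H + n + 1"
  define m where "m = 2 * N + 2 * H + 4 - H"
  define x where "x = right_first_tour a N H H"
  define y where "y = left_first_tour a N H H"
  define s where "s = x0_power (2 * H) False"
  have xy: "x @ s \<approx> y"
    using tours_differ_by_x0_power[of a H N H] a(2) by (simp add: x_def y_def s_def N_def)
  have x_letters: "fst ` set x \<subseteq> I" and y_letters: "fst ` set y \<subseteq> I" and s_letters: "fst ` set s \<subseteq> I"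
    using a(1) I(2) by (auto simp: x_def y_def s_def right_first_tour_def left_first_tour_def)
  have "length x \<le> m" "length y \<le> m"
    by (simp_all add: x_def y_def m_def right_first_tour_def left_first_tour_def N_def)
  then have "x \<in> ball_words I m" "y \<in> ball_words I m"
    using x_letters y_letters pres_eq.refl unfolding ball_words_def by blast+
  \<comment> \<open>The straight path from \<open>x\<close> to \<open>y\<close> leaves the ball by at most \<open>2 * H\<close> layers.\<close>
  have "x @ take k s \<in> ball_words I (m + 2 * H)" for k
  proof -
    have "fst ` set (x @ take k s) \<subseteq> I"
      using x_letters order.trans[OF image_mono[OF set_take_subset] s_letters]
      by (simp add: image_Un)
    moreover have "length (x @ take k s) \<le> m + 2 * H"
      using \<open>length x \<le> m\<close> by (simp add: s_def)
    ultimately show ?thesis using pres_eq.refl unfolding ball_words_def by blast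
  qed
  then have "word_path I (ball_words I (m + 2 * H)) x s"
    using s_letters by (simp add: word_path_def)
  moreover have "x @ s \<in> ball_words I m"
    by (rule ball_words_cong[OF pres_eq.sym[OF xy] \<open>y \<in> ball_words I m\<close>])
  moreover have "m > 0" by (simp add: m_def)
  ultimately obtain p where p: "length p \<le> L ^ (2 * H) * length s"
    "word_path I (ball_words I m) x p" "x @ p \<approx> x @ s"
    using almost_convex_far[OF L(1) _ L(2), of m "2 * H" x s] \<open>x \<in> ball_words I m\<close> by blast
  have "N \<ge> length p + H + n + 1" using p(1) by (simp add: N_def s_def)
  then show False
    using no_short_path_between_tours[OF n a H_def _ order.refl, of p N]
      p(2) pres_eq.trans[OF p(3) xy]
    by (simp add: x_def y_def m_def)
qed

end
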